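(* Let $d\ge1$ and let $(\mathbb Z^d,E,\mu,w)$ be the weighted nearest-neighbour lattice graph with vertex measure $\mu(x)=\sum_{y\sim x}w_{xy}$, satisfying $0<\mu_{\min}\le\mu_{\max}<\infty$ and $\inf_{x\sim y}w_{xy}>0$, with normalized Laplacian $\Delta$ and heat kernel $p(t,x,y)$. Let $$W(x,y)=\mu(x)\mu(y)\int_1^\infty p(t,x,y)\,\frac{dt}{t}.$$ Then there exists a sequence $\{u_n\}_{n\ge1}\subset\ell^2(\mathbb Z^d)$ with $\|u_n\|_{\ell^2(\mathbb Z^d)}=1$ such that $$\sum_{x,y\in\mathbb Z^d}u_n(x)\,u_n(y)\,W(x,y)\longrightarrow+\infty\qquad\text{as }n\to\infty .$$
   Context: Weighted lattice graph: vertex set $\mathbb Z^d$, with $x\sim y$ iff $|x-y|_1=1$; symmetric weights $w_{xy}=w_{yx}>0$ if $x\sim y$ and $w_{xy}=0$ otherwise (in particular $w_{xx}=0$); $\mu(x)=\sum_{y\sim x}w_{xy}$; $\mu_{\min}=\inf_x\mu(x)$, $\mu_{\max}=\sup_x\mu(x)$. The normalized Laplacian is $\Delta u(x)=\frac1{\mu(x)}\sum_{y\sim x}w_{xy}(u(y)-u(x))$, a bounded self-adjoint operator on $\ell^2(\mathbb Z^d,\mu)$. The heat kernel $p(t,x,y)$, $t\ge0$, is defined by $e^{t\Delta}u(x)=\sum_{y}p(t,x,y)u(y)\mu(y)$, i.e. $p(t,x,y)=\mu(y)^{-1}(e^{t\Delta}\mathbf 1_{\{y\}})(x)$. Norm: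 $\|u\|_{\ell^2(\mathbb Z^d)}^2=\sum_x|u(x)|^2\mu(x)$. *)

theory Defs
  imports "HOL-Analysis.Analysis"
begin

definition adj :: "int ^ 'd \<Rightarrow> int ^ 'd \<Rightarrow> bool" where
  "adj x y \<longleftrightarrow> (\<Sum>i\<in>UNIV. \<bar>x $ i - y $ i\<bar>) = 1"

lemma finite_adj: "finite {y. adj x y}"
proof -
  have "\<bar>x $ i - y $ i\<bar> \<le> 1" if "adj x y" for y i
    using member_le_sum[of i UNIV "\<lambda>i. \<bar>x $ i - y $ i\<bar>"] that by (simp add: adj_def)
  then have "{y. adj x y} \<subseteq> vec_lambda ` (PiE UNIV (\<lambda>i. {x $ i - 1 .. x $ i + 1}))"
    by (auto intro!: image_eqI[where x = "\<lambda>i. _ $ i"] simp: abs_le_iff vec_eq_iff algebra_simps)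
  then show ?thesis
    by (rule finite_subset) (auto intro!: finite_PiE)
qed

definition vertex_measure :: "(int ^ 'd \<Rightarrow> int ^ 'd \<Rightarrow> real) \<Rightarrow> int ^ 'd \<Rightarrow> real" where
  "vertex_measure w x = (\<Sum>y | adj x y. w x y)"

text \<open>The extrema are taken in \<^typ>\<open>ereal\<close>, so that they are meaningful without boundedness.\<close>

definition mu_min :: "(int ^ 'd \<Rightarrow> int ^ 'd \<Rightarrow> real) \<Rightarrow> ereal" where
  "mu_min w = (INF x. ereal (vertex_measure w x))"

definition mu_max :: "(int ^ 'd \<Rightarrow> int ^ 'd \<Rightarrow> real) \<Rightarrow> ereal" where
  "mu_max w = (SUP x. ereal (vertex_measure w x))"

definition ell2 :: "(int ^ 'd \<Rightarrow> int ^ 'd \<Rightarrow> real) \<Rightarrow> (int ^ 'd \<Rightarrow> real) set" where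
  "ell2 w = {u. (\<lambda>x. \<bar>u x\<bar>\<^sup>2 * vertex_measure w x) summable_on UNIV}"

definition ell2_norm :: "(int ^ 'd \<Rightarrow> int ^ 'd \<Rightarrow> real) \<Rightarrow> (int ^ 'd \<Rightarrow> real) \<Rightarrow> real" where
  "ell2_norm w u = sqrt (\<Sum>\<^sub>\<infinity>x. \<bar>u x\<bar>\<^sup>2 * vertex_measure w x)"

definition laplacian ::
    "(int ^ 'd \<Rightarrow> int ^ 'd \<Rightarrow> real) \<Rightarrow> (int ^ 'd \<Rightarrow> real) \<Rightarrow> int ^ 'd \<Rightarrow> real" where
  "laplacian w u x = (\<Sum>y | adj x y. w x y * (u y - u x)) / vertex_measure w x"

text \<open>
  The exponential of \<open>t\<close> times the Laplacian on the weighted space \<open>\<ell>\<^sup>2\<close>: for \<open>u\<close> in \<open>\<ell>\<^sup>2\<close>, the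
  value is the limit in the \<open>\<ell>\<^sup>2\<close> norm of the partial sums of the exponential series applied
  to \<open>u\<close>. Membership of \<open>v\<close> in \<open>\<ell>\<^sup>2\<close> is required explicitly because \<^const>\<open>ell2_norm\<close> is \<open>0\<close>
  outside \<^const>\<open>ell2\<close>.
\<close>

definition heat_semigroup ::
    "(int ^ 'd \<Rightarrow> int ^ 'd \<Rightarrow> real) \<Rightarrow> real \<Rightarrow> (int ^ 'd \<Rightarrow> real) \<Rightarrow> int ^ 'd \<Rightarrow> real" where
  "heat_semigroup w t u = (THE v. v \<in> ell2 w \<and>
     (\<lambda>N. ell2_norm w (\<lambda>x. v x - (\<Sum>k<N. t ^ k / fact k * (laplacian w ^^ k) u x)))
       \<longlonglongrightarrow> 0)"

definition heat_kernel ::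
    "(int ^ 'd \<Rightarrow> int ^ 'd \<Rightarrow> real) \<Rightarrow> real \<Rightarrow> int ^ 'd \<Rightarrow> int ^ 'd \<Rightarrow> real" where
  "heat_kernel w t x y = heat_semigroup w t (indicator {y}) x / vertex_measure w y"

text \<open>
  For weights bounded above and below the integrand is nonnegative and bounded by a multiple of
  \<open>t powr (-1 - d / 2)\<close>, so the integral converges.
\<close>

definition W_kernel ::
    "(int ^ 'd \<Rightarrow> int ^ 'd \<Rightarrow> real) \<Rightarrow> int ^ 'd \<Rightarrow> int ^ 'd \<Rightarrow> real" where
  "W_kernel w x y = vertex_measure w x * vertex_measure w y *
     (LINT t:{1..}|lborel. heat_kernel w t x y / t)"

end

theory Submission
  imports Defs
begin

text \<open>
  Write \<open>P\<close> for the transition operator of the random walk, so that the Laplacian is \<open>P - 1\<close> and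
  the heat semigroup is the average of the powers of \<open>P\<close> with Poisson weights,
  \<open>exp (- t) * (\<Sum>k. t ^ k / fact k * P ^ k)\<close> (\<open>heat_semigroup_eq\<close>). The quadratic form of the kernel
  at \<open>u\<close> is the integral of \<open>f t / t\<close> over \<open>t \<ge> 1\<close>, where \<open>f t\<close> is the inner product of \<open>u\<close> with
  its evolution at time \<open>t\<close>. For a normalized \<open>u\<close> of small energy, \<open>f\<close> stays close to \<open>1\<close> for a long
  time, and the integral of \<open>1 / t\<close> diverges logarithmically.

  The test functions are normalized indicators of cubes. For an indicator of a set \<open>B\<close>
  every quantity has a probabilistic meaning: the mass that has left \<open>B\<close> after \<open>k\<close> steps is at most \<open>k\<close> times the
  measure of the inner boundary of \<open>B\<close> (\<open>overlap_ge\<close>). Hence the form at the normalized indicator is at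
  least \<open>ln R / 2\<close> as long as \<open>R\<close> times the boundary is at most half the measure of \<open>B\<close>
  (\<open>sum_W_kernel_ge\<close>). The boundary of a cube of side \<open>n\<close> is negligible relative to its volume as
  \<open>n\<close> grows, so \<open>R\<close> can be taken arbitrarily large.

  The kernel is defined by an integral over an infinite range, so one also has to know that this
  integral converges (\<open>heat_integrable\<close>). Any polynomial decay of the heat kernel is enough. It comes
  from a Nash inequality: one step of the walk decreases the squared norm by at least a multiple of
  the squared differences between points at distance two, and summation along a single ray of the
  lattice bounds the supremum by this dissipation (\<open>fourth_power_le_dissipation\<close>). Together with
  conservation of mass this forces decay of the powers of \<open>P\<close> (\<open>transition_power_decay\<close>), and
  averaging over the Poisson weights transfers the decay to continuous time
  (\<open>poisson_average_le\<close>).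
\<close>

section \<open>The walk operator and sums against the vertex measure\<close>

text \<open>
  This is the Markov operator \<open>P\<close> of the random walk on the weighted graph, in discrete time.
\<close>

definition transition :: "(int ^ 'd \<Rightarrow> int ^ 'd \<Rightarrow> real) \<Rightarrow> (int ^ 'd \<Rightarrow> real) \<Rightarrow> int ^ 'd \<Rightarrow> real" where
  "transition w u x = (\<Sum>y | adj x y. w x y * u y) / vertex_measure w x"

definition total :: "(int ^ 'd \<Rightarrow> int ^ 'd \<Rightarrow> real) \<Rightarrow> (int ^ 'd \<Rightarrow> real) \<Rightarrow> real" where
  "total w f = (\<Sum>\<^sub>\<infinity>x. f x * vertex_measure w x)"

text \<open>
  \<open>P\<close> enlarges a support by one lattice step only, so its powers keep point masses and indicators
  of finite sets finitely supported, and their sums over the lattice are sums over some large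
  enough finite set.
\<close>

definition fin_supp :: "('a \<Rightarrow> real) \<Rightarrow> bool" where
  "fin_supp f \<longleftrightarrow> finite {x. f x \<noteq> 0}"

lemma fin_suppI: "finite S \<Longrightarrow> (\<And>x. x \<notin> S \<Longrightarrow> f x = 0) \<Longrightarrow> fin_supp f"
  unfolding fin_supp_def by (rule finite_subset[of _ S]) auto

lemma fin_supp_diff: "fin_supp f \<Longrightarrow> fin_supp g \<Longrightarrow> fin_supp (\<lambda>x. f x - g x)"
  by (rule fin_suppI[of "{x. f x \<noteq> 0} \<union> {x. g x \<noteq> 0}"]) (auto simp: fin_supp_def)

lemma fin_supp_mult: "fin_supp f \<Longrightarrow> fin_supp (\<lambda>x. f x * g x)"
  by (rule fin_suppI[of "{x. f x \<noteq> 0}"]) (auto simp: fin_supp_def)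

lemma adj_commute: "adj x y \<longleftrightarrow> adj y x"
  by (simp add: adj_def abs_minus_commute)

lemma adj_axis: "adj x (x + axis i 1)" "adj x (x - axis i 1)"
proof -
  have "(\<Sum>j\<in>UNIV. \<bar>axis i (1::int) $ j\<bar>) = 1"
    by (simp add: axis_def if_distrib[of abs] cong: if_cong)
  then show "adj x (x + axis i 1)" "adj x (x - axis i 1)"
    by (simp_all add: adj_def)
qed

text \<open>
  Ellipticity with the constants made explicit: \<open>c\<close> bounds the edge weights, and hence the vertex
  measure, from below.
\<close>

locale lattice_weights =
  fixes w :: "int ^ 'd \<Rightarrow> int ^ 'd \<Rightarrow> real" and c M :: real
  assumes w_sym: "w x y = w y x"
    and w_zero: "\<not> adj x y \<Longrightarrow> w x y = 0"
    and c_pos: "0 < c"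
    and w_ge: "adj x y \<Longrightarrow> c \<le> w x y"
    and measure_le: "vertex_measure w x \<le> M"
begin

abbreviation \<mu> where "\<mu> \<equiv> vertex_measure w"
abbreviation P where "P \<equiv> transition w"
abbreviation T where "T \<equiv> total w"

lemma w_nonneg: "0 \<le> w x y"
  using w_ge[of x y] w_zero[of x y] c_pos by (cases "adj x y") auto

lemma measure_ge: "c \<le> \<mu> x"
proof -
  fix i :: 'd
  have "w x (x + axis i 1) \<le> (\<Sum>y | adj x y. w x y)"
    by (rule member_le_sum) (auto simp: adj_axis w_nonneg finite_adj)
  with w_ge[OF adj_axis(1)[of x i]] show ?thesis
    unfolding vertex_measure_def by linarith
qed

lemma measure_pos: "0 < \<mu> x"
  using measure_ge[of x] c_pos by linarith

text \<open>
  The weights vanish off the edges, so the sum over neighbours may be taken over any finite set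
  that contains the support of \<open>u\<close>. In this form sums over the lattice can be interchanged.
\<close>

lemma measure_times_transition:
  assumes "finite S" "\<And>y. y \<notin> S \<Longrightarrow> u y = 0"
  shows "P u x * \<mu> x = (\<Sum>y\<in>S. w x y * u y)"
proof -
  have "P u x * \<mu> x = (\<Sum>y | adj x y. w x y * u y)"
    using measure_pos[of x] by (simp add: transition_def)
  also have "\<dots> = (\<Sum>y\<in>S \<union> {y. adj x y}. w x y * u y)"
    using assms by (intro sum.mono_neutral_left) (auto simp: finite_adj w_zero)
  also have "\<dots> = (\<Sum>y\<in>S. w x y * u y)"
    using assms by (intro sum.mono_neutral_right) (auto simp: finite_adj)
  finally show ?thesis .
qed

lemma transition_mono: "(\<And>x. u x \<le> v x) \<Longrightarrow> P u x \<le> P v x"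
  unfolding transition_def using measure_pos[of x]
  by (intro divide_right_mono sum_mono mult_left_mono) (auto simp: w_nonneg)

lemma transition_const: "P (\<lambda>_. a) x = a"
  using measure_pos[of x]
  by (simp add: transition_def vertex_measure_def flip: sum_distrib_right)

lemma transition_add: "P (\<lambda>x. u x + v x) x = P u x + P v x"
  by (simp add: transition_def distrib_left sum.distrib add_divide_distrib)

lemma transition_scale: "P (\<lambda>x. a * u x) x = a * P u x"
  by (simp add: transition_def sum_distrib_left ac_simps)

lemma transition_sum: "P (\<lambda>x. \<Sum>i\<in>I. f i x) x = (\<Sum>i\<in>I. P (f i) x)"
proof (induction I rule: infinite_finite_induct)
  case (insert i I)
  then show ?case by (simp add: transition_add)
qed (simp_all add: transition_const)

lemma laplacian_eq: "laplacian w u x = P u x - u x"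
  using measure_pos[of x]
  by (simp add: laplacian_def transition_def vertex_measure_def right_diff_distrib
      sum_subtractf diff_divide_distrib flip: sum_distrib_right)

lemma fin_supp_transition:
  assumes "fin_supp u" shows "fin_supp (P u)"
proof (rule fin_suppI)
  show "finite (\<Union>y\<in>{y. u y \<noteq> 0}. {x. adj y x})"
    using assms by (auto simp: fin_supp_def finite_adj)
next
  fix x assume "x \<notin> (\<Union>y\<in>{y. u y \<noteq> 0}. {x. adj y x})"
  then have "(\<Sum>y | adj x y. w x y * u y) = 0"
    by (intro sum.neutral) (auto simp: adj_commute)
  then show "P u x = 0" by (simp add: transition_def)
qed

lemma fin_supp_transition_power: "fin_supp u \<Longrightarrow> fin_supp ((P ^^ k) u)"
  by (induction k) (auto simp: fin_supp_transition)

lemma total_eq_sum: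
  assumes "finite S" "\<And>x. x \<notin> S \<Longrightarrow> f x = 0"
  shows "T f = (\<Sum>x\<in>S. f x * \<mu> x)"
proof -
  have "T f = (\<Sum>\<^sub>\<infinity>x\<in>S. f x * \<mu> x)"
    unfolding total_def using assms(2) by (intro infsum_cong_neutral) auto
  then show ?thesis using assms(1) by simp
qed

lemma total_diff:
  assumes "fin_supp f" "fin_supp g"
  shows "T (\<lambda>x. f x - g x) = T f - T g"
proof -
  let ?S = "{x. f x \<noteq> 0} \<union> {x. g x \<noteq> 0}"
  have S: "finite ?S" using assms by (simp add: fin_supp_def)
  show ?thesis
    by (subst (1 2 3) total_eq_sum[OF S]) (auto simp: left_diff_distrib sum_subtractf)
qed

lemma total_nonneg: "(\<And>x. 0 \<le> f x) \<Longrightarrow> 0 \<le> T f"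
  unfolding total_def using measure_pos by (intro infsum_nonneg mult_nonneg_nonneg) (auto intro: less_imp_le)

lemma total_mono:
  assumes "fin_supp f" "fin_supp g" "\<And>x. f x \<le> g x"
  shows "T f \<le> T g"
  using total_diff[OF assms(2,1)] total_nonneg[of "\<lambda>x. g x - f x"] assms(3) by simp

lemma sum_le_total:
  assumes "fin_supp f" "\<And>x. 0 \<le> f x" "finite F"
  shows "(\<Sum>x\<in>F. f x * \<mu> x) \<le> T f"
proof -
  have "finite (F \<union> {x. f x \<noteq> 0})" using assms by (simp add: fin_supp_def)
  then have "T f = (\<Sum>x\<in>F \<union> {x. f x \<noteq> 0}. f x * \<mu> x)"
    by (rule total_eq_sum) auto
  also have "\<dots> \<ge> (\<Sum>x\<in>F. f x * \<mu> x)"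
    using assms measure_pos
    by (intro sum_mono2) (auto simp: fin_supp_def intro!: mult_nonneg_nonneg less_imp_le[OF measure_pos])
  finally show ?thesis .
qed

text \<open>
  Reversibility: both sides equal the sum of \<open>f x * w x y * g y\<close> over all pairs, and \<open>w\<close> is
  symmetric.
\<close>

lemma transition_selfadjoint:
  assumes "fin_supp f" "fin_supp g"
  shows "T (\<lambda>x. f x * P g x) = T (\<lambda>x. P f x * g x)"
proof -
  let ?S = "{x. f x \<noteq> 0} \<union> {x. g x \<noteq> 0}"
  have S: "finite ?S" using assms by (simp add: fin_supp_def)
  have pg: "P g x * \<mu> x = (\<Sum>y\<in>?S. w x y * g y)" for x
    by (rule measure_times_transition[OF S]) auto
  have pf: "P f x * \<mu> x = (\<Sum>y\<in>?S. w x y * f y)" for x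
    by (rule measure_times_transition[OF S]) auto
  have "T (\<lambda>x. f x * P g x) = (\<Sum>x\<in>?S. f x * (P g x * \<mu> x))"
    by (subst total_eq_sum[OF S]) (auto simp: ac_simps)
  also have "\<dots> = (\<Sum>x\<in>?S. \<Sum>y\<in>?S. f x * (w x y * g y))"
    unfolding pg by (simp add: sum_distrib_left)
  also have "\<dots> = (\<Sum>y\<in>?S. \<Sum>x\<in>?S. f x * (w x y * g y))"
    by (rule sum.swap)
  also have "\<dots> = (\<Sum>y\<in>?S. g y * (P f y * \<mu> y))"
    unfolding pf by (intro sum.cong refl) (simp add: sum_distrib_left w_sym ac_simps)
  also have "\<dots> = T (\<lambda>x. P f x * g x)"
    by (subst total_eq_sum[OF S]) (auto simp: ac_simps)
  finally show ?thesis .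
qed

text \<open>
  Conservation of mass is self-adjointness against the constant \<open>1\<close>, here replaced by the indicator
  of a finite set containing all neighbours of the support.
\<close>

lemma total_transition:
  assumes "fin_supp u" shows "T (P u) = T u"
proof -
  let ?S = "{x. u x \<noteq> 0}"
  let ?R = "?S \<union> {x. P u x \<noteq> 0}"
  let ?N = "?R \<union> (\<Union>x\<in>?S. {y. adj x y})"
  have R: "finite ?N" using assms fin_supp_transition[OF assms] by (auto simp: fin_supp_def finite_adj)
  have "T (P u) = T (\<lambda>x. indicator ?N x * P u x)"
    by (rule arg_cong[of _ _ T]) (auto simp: indicator_def)
  also have "\<dots> = T (\<lambda>x. P (indicator ?N) x * u x)"
    using assms R by (intro transition_selfadjoint) (auto intro: fin_suppI[of ?N])
  also have "(\<lambda>x. P (indicator ?N) x * u x) = u"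
  proof
    fix x
    have "P (indicator ?N) x = 1" if "u x \<noteq> 0"
    proof -
      have "(\<Sum>y | adj x y. w x y * indicator ?N y) = (\<Sum>y | adj x y. w x y)"
        using that by (intro sum.cong) (auto simp: indicator_def)
      then show ?thesis using measure_pos[of x] by (simp add: transition_def vertex_measure_def)
    qed
    then show "P (indicator ?N) x * u x = u x" by (cases "u x = 0") auto
  qed
  finally show ?thesis .
qed

section \<open>The dissipation inequality\<close>

text \<open>
  The factor \<open>P (v\<^sup>2) z - (P v z)\<^sup>2\<close> is the variance of \<open>v\<close> at the position of the walk after one step
  from \<open>z\<close>. Two of the possible positions are \<open>z\<close> plus or minus a unit vector, and each is
  reached with probability at least \<open>c / \<mu> z\<close>; the values of \<open>v\<close> there differ from the mean by a
  total of at least their mutual distance. Comparing two points at distance two avoids the parity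
  obstruction: functions alternating between even and odd sites are not contracted by \<open>P\<close>.
\<close>

lemma local_variance:
  "c / 2 * (v (z + axis i 1) - v (z - axis i 1))\<^sup>2 \<le> (P (\<lambda>x. (v x)\<^sup>2) z - (P v z)\<^sup>2) * \<mu> z"
proof -
  define m where "m = P v z"
  let ?a = "z + axis i 1" and ?b = "z - axis i 1"
  have m: "m * \<mu> z = (\<Sum>y | adj z y. w z y * v y)"
    using measure_pos[of z] by (simp add: m_def transition_def)
  have ne: "?a \<noteq> ?b"
    by (auto simp: vec_eq_iff axis_def dest!: spec[of _ i])
  have "(v ?a - v ?b)\<^sup>2 \<le> 2 * ((v ?a - m)\<^sup>2 + (v ?b - m)\<^sup>2)"
    using zero_le_power2[of "(v ?a - m) + (v ?b - m)"] by (simp add: power2_eq_square algebra_simps)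
  then have "c / 2 * (v ?a - v ?b)\<^sup>2 \<le> c * (v ?a - m)\<^sup>2 + c * (v ?b - m)\<^sup>2"
    using mult_left_mono[of _ _ "c / 2"] c_pos by (fastforce simp: field_simps)
  also have "\<dots> \<le> (\<Sum>y\<in>{?a, ?b}. w z y * (v y - m)\<^sup>2)"
    using ne w_ge adj_axis[of z i] by (auto intro!: add_mono mult_right_mono)
  also have "\<dots> \<le> (\<Sum>y | adj z y. w z y * (v y - m)\<^sup>2)"
    by (intro sum_mono2) (auto simp: finite_adj adj_axis w_nonneg)
  also have "\<dots> = (\<Sum>y | adj z y. w z y * (v y)\<^sup>2) - 2 * m * (\<Sum>y | adj z y. w z y * v y) + m\<^sup>2 * \<mu> z"
    by (simp add: power2_diff algebra_simps sum.distrib sum_subtractf vertex_measure_def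
        sum_distrib_left)
  also have "\<dots> = (P (\<lambda>x. (v x)\<^sup>2) z - m\<^sup>2) * \<mu> z"
    unfolding m[symmetric] using measure_pos[of z]
    by (simp add: transition_def field_simps power2_eq_square)
  finally show ?thesis by (simp add: m_def)
qed

text \<open>
  Over the whole lattice the local variances add up to the loss of the squared norm in one step,
  because \<open>P\<close> preserves the total of \<open>v\<^sup>2\<close>.
\<close>

lemma square_gradient_le_dissipation:
  assumes "fin_supp v" "finite F"
  shows "c / 2 * (\<Sum>z\<in>F. (v (z + axis i 1) - v (z - axis i 1))\<^sup>2)
    \<le> T (\<lambda>x. (v x)\<^sup>2) - T (\<lambda>x. (P v x)\<^sup>2)"
proof -
  note Pv = fin_supp_transition[OF assms(1)]
  have sq: "fin_supp (\<lambda>x. (v x)\<^sup>2)" "fin_supp (\<lambda>x. (P v x)\<^sup>2)"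
    using fin_supp_mult[OF assms(1), of v] fin_supp_mult[OF Pv, of "P v"]
    by (auto simp: power2_eq_square)
  let ?g = "\<lambda>x. P (\<lambda>x. (v x)\<^sup>2) x - (P v x)\<^sup>2"
  have "c / 2 * (\<Sum>z\<in>F. (v (z + axis i 1) - v (z - axis i 1))\<^sup>2) \<le> (\<Sum>z\<in>F. ?g z * \<mu> z)"
    unfolding sum_distrib_left by (intro sum_mono local_variance)
  also have "\<dots> \<le> T ?g"
  proof (rule sum_le_total)
    show "fin_supp ?g" by (intro fin_supp_diff fin_supp_transition sq)
    have "0 \<le> ?g x * \<mu> x" for x
      by (rule order_trans[OF _ local_variance[of v x]]) (use c_pos in auto)
    then show "0 \<le> ?g x" for x
      using measure_pos[of x] by (metis zero_le_mult_iff not_less)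
  qed fact
  also have "T ?g = T (\<lambda>x. (v x)\<^sup>2) - T (\<lambda>x. (P v x)\<^sup>2)"
    by (subst total_diff) (auto intro!: fin_supp_transition sq simp: total_transition[OF sq(1)])
  finally show ?thesis .
qed

text \<open>
  The one-dimensional Sobolev inequality along a ray. From \<open>z\<close> walk in steps of length two in a
  fixed coordinate direction until the support of \<open>v\<close> is left; then \<open>(v z)\<^sup>2\<close> is the telescoping sum
  of the differences of squares \<open>(s j - s (j + 1)) * (s j + s (j + 1))\<close>, to which the
  Cauchy-Schwarz inequality applies. One ray suffices in every dimension, at the price of a decay
  rate that is not optimal for \<open>d > 1\<close>.
\<close>

lemma fourth_power_le_dissipation:
  assumes v: "fin_supp v"
  shows "v z ^ 4 \<le> 8 / c\<^sup>2 * T (\<lambda>x. (v x)\<^sup>2) * (T (\<lambda>x. (v x)\<^sup>2) - T (\<lambda>x. (P v x)\<^sup>2))"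
proof -
  fix i :: 'd
  define e :: "int ^ 'd" where "e = axis i 1"
  define ray where "ray j = z + (\<chi> l. of_nat (2 * j) * e $ l)" for j :: nat
  define mid where "mid j = z + (\<chi> l. of_nat (2 * j + 1) * e $ l)" for j :: nat
  define s where "s j = v (ray j)" for j
  define b where "b = T (\<lambda>x. (v x)\<^sup>2)"
  define D where "D = b - T (\<lambda>x. (P v x)\<^sup>2)"
  have ei: "e $ i = 1" by (simp add: e_def)
  have inj_ray: "inj ray" and inj_mid: "inj mid"
    by (auto simp: inj_def ray_def mid_def vec_eq_iff ei dest!: spec[of _ i])
  have mid: "mid j + e = ray (Suc j)" "mid j - e = ray j" for j
    by (auto simp: mid_def ray_def vec_eq_iff algebra_simps)
  (* The ray is infinite and the support is finite. *)
  have "\<exists>N. s N = 0"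
  proof (rule ccontr)
    assume "\<nexists>N. s N = 0"
    then have "range ray \<subseteq> {x. v x \<noteq> 0}" by (auto simp: s_def)
    with v have "finite (range ray)" by (auto simp: fin_supp_def intro: finite_subset)
    with inj_ray show False using finite_imageD by blast
  qed
  then obtain N where N: "s N = 0" ..
  have s0: "s 0 = v z" by (simp add: s_def ray_def vec_eq_iff zero_vec_def[symmetric])
  have sq_le: "(\<Sum>x\<in>F. (v x)\<^sup>2) \<le> b / c" if "finite F" for F
  proof -
    have "c * (\<Sum>x\<in>F. (v x)\<^sup>2) \<le> (\<Sum>x\<in>F. (v x)\<^sup>2 * \<mu> x)"
      unfolding sum_distrib_left using measure_ge
      by (intro sum_mono) (auto simp: mult.commute intro!: mult_right_mono)
    also have "\<dots> \<le> b" unfolding b_def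
      using that fin_supp_mult[OF v, of v] by (intro sum_le_total) (auto simp: power2_eq_square)
    finally show ?thesis using c_pos by (simp add: field_simps)
  qed
  have "(v z)\<^sup>2 = (\<Sum>j<N. (s j)\<^sup>2 - (s (Suc j))\<^sup>2)"
    using sum_lessThan_telescope'[of "\<lambda>j. (s j)\<^sup>2" N] by (simp add: N s0)
  also have "\<dots> = (\<Sum>j<N. (s j - s (Suc j)) * (s j + s (Suc j)))"
    by (simp add: power2_eq_square algebra_simps)
  finally have "v z ^ 4 = (\<Sum>j<N. (s j - s (Suc j)) * (s j + s (Suc j)))\<^sup>2"
    by (metis power2_eq_square power_mult numeral_Bit0 mult_2 power_add)
  also have "\<dots> \<le> (\<Sum>j<N. (s j - s (Suc j))\<^sup>2) * (\<Sum>j<N. (s j + s (Suc j))\<^sup>2)"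
    by (rule Cauchy_Schwarz_ineq_sum)
  also have "\<dots> \<le> (2 / c * D) * (4 * (b / c))"
  proof (rule mult_mono)
    have "(\<Sum>j<N. (s j - s (Suc j))\<^sup>2) = (\<Sum>x\<in>mid ` {..<N}. (v (x + e) - v (x - e))\<^sup>2)"
      by (subst sum.reindex) (auto intro: inj_on_subset[OF inj_mid] simp: mid s_def power2_commute)
    then show "(\<Sum>j<N. (s j - s (Suc j))\<^sup>2) \<le> 2 / c * D"
      using square_gradient_le_dissipation[OF v, of "mid ` {..<N}" i] c_pos
      by (simp add: D_def b_def e_def field_simps)
    have "(\<Sum>j<N. (s j + s (Suc j))\<^sup>2) \<le> (\<Sum>j<N. 2 * (s j)\<^sup>2 + 2 * (s (Suc j))\<^sup>2)"
      using zero_le_power2[of "s j - s (Suc j)" for j]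
      by (intro sum_mono) (simp add: power2_eq_square algebra_simps)
    also have "\<dots> = 2 * (\<Sum>j<N. (s j)\<^sup>2) + 2 * (\<Sum>j<N. (s (Suc j))\<^sup>2)"
      by (simp add: sum.distrib sum_distrib_left)
    also have "(\<Sum>j<N. (s j)\<^sup>2) = (\<Sum>x\<in>ray ` {..<N}. (v x)\<^sup>2)"
      by (subst sum.reindex) (auto intro: inj_on_subset[OF inj_ray] simp: s_def)
    also have "\<dots> \<le> b / c" by (rule sq_le) simp
    also have "(\<Sum>j<N. (s (Suc j))\<^sup>2) = (\<Sum>x\<in>ray ` Suc ` {..<N}. (v x)\<^sup>2)"
      by (subst sum.reindex, auto intro: inj_on_subset[OF inj_ray])+ (auto simp: s_def)
    also have "\<dots> \<le> b / c" by (rule sq_le) simp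
    finally show "(\<Sum>j<N. (s j + s (Suc j))\<^sup>2) \<le> 4 * (b / c)" by simp
    show "0 \<le> 2 / c * D"
      using square_gradient_le_dissipation[OF v, of "{}" i] c_pos by (simp add: D_def b_def)
  qed (auto intro: sum_nonneg)
  also have "\<dots> = 8 / c\<^sup>2 * b * D" by (simp add: power2_eq_square)
  finally show ?thesis by (simp add: b_def D_def)
qed

section \<open>Polynomial decay of the transition probabilities\<close>

lemma transition_power_bounds:
  assumes "\<And>x. 0 \<le> u x" "\<And>x. u x \<le> 1"
  shows "0 \<le> (P ^^ k) u x \<and> (P ^^ k) u x \<le> 1"
proof (induction k arbitrary: x)
  case (Suc k)
  have "P (\<lambda>_. 0) x \<le> P ((P ^^ k) u) x" "P ((P ^^ k) u) x \<le> P (\<lambda>_. 1) x"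
    using Suc by (auto intro!: transition_mono)
  then show ?case by (simp add: transition_const)
qed (use assms in auto)

lemma total_indicator: "T (indicator {y}) = \<mu> y"
  by (subst total_eq_sum[of "{y}"]) auto

lemma fin_supp_indicator: "finite S \<Longrightarrow> fin_supp (indicator S)"
  by (rule fin_suppI[of S]) auto

lemma total_transition_power: "fin_supp u \<Longrightarrow> T ((P ^^ k) u) = T u"
  by (induction k) (simp_all add: total_transition fin_supp_transition_power)

text \<open>
  Let \<open>v\<^sub>k\<close> be the \<open>k\<close>-th power of \<open>P\<close> applied to a point mass and \<open>b\<^sub>k\<close> its squared norm. Since
  the mass of \<open>v\<^sub>k\<close> is conserved, \<open>b\<^sub>k\<close> is at most \<open>\<mu> y\<close> times the supremum of \<open>v\<^sub>k\<close>, and bounding this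
  supremum by the dissipation inequality yields the discrete Nash inequality
  \<open>b\<^sub>k ^ 3 \<le> A * (b\<^sub>k - b\<^sub>k\<^sub>+\<^sub>1)\<close>. Its right-hand side telescopes and \<open>b\<close> is decreasing, so
  \<open>(k + 1) * b\<^sub>k ^ 3\<close> is bounded. A pointwise bound follows from \<open>c * (v\<^sub>k z)\<^sup>2 \<le> b\<^sub>k\<close>. The exponent \<open>1/6\<close>
  obtained in this way is far from sharp, but any positive power of \<open>k\<close> makes the integral
  of the heat kernel against \<open>dt / t\<close> converge.
\<close>

lemma transition_power_decay:
  "(k + 1) * ((P ^^ k) (indicator {y}) z) ^ 6 \<le> 8 * (M / c) ^ 5"
proof -
  define v where "v k = (P ^^ k) (indicator {y})" for k
  define b where "b k = T (\<lambda>x. (v k x)\<^sup>2)" for k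
  define A where "A = 8 / c\<^sup>2 * \<mu> y ^ 4"
  have v_fin: "fin_supp (v k)" for k
    unfolding v_def by (intro fin_supp_transition_power fin_supp_indicator) simp
  have sq_fin: "fin_supp (\<lambda>x. (v k x)\<^sup>2)" for k
    using fin_supp_mult[OF v_fin[of k], of "v k"] by (simp add: power2_eq_square)
  have v_nonneg: "0 \<le> v k x" for k x
    using transition_power_bounds[of "indicator {y}"] by (auto simp: v_def)
  have v_total: "T (v k) = \<mu> y" for k
    unfolding v_def by (simp add: total_transition_power fin_supp_indicator total_indicator)
  have v_Suc: "P (v k) = v (Suc k)" for k by (simp add: v_def)
  have b_nonneg: "0 \<le> b k" for k unfolding b_def by (intro total_nonneg) simp
  have b_decr: "b (Suc k) \<le> b k" for k
    using square_gradient_le_dissipation[OF v_fin[of k], of "{}"] by (simp add: b_def v_Suc)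
  have sup: "b k \<le> r * \<mu> y" if "\<And>x. v k x \<le> r" for k r
  proof -
    have "b k \<le> T (\<lambda>x. v k x * r)"
      unfolding b_def using that v_nonneg v_fin sq_fin
      by (intro total_mono fin_supp_mult) (auto simp: power2_eq_square intro!: mult_left_mono)
    also have "\<dots> = r * T (v k)"
      by (simp add: total_def infsum_cmult_right' ac_simps flip: infsum_cmult_right')
    finally show ?thesis by (simp add: v_total)
  qed
  have cube: "b k ^ 3 \<le> A * (b k - b (Suc k))" for k
  proof (cases "b k = 0")
    case False
    define X where "X = 8 / c\<^sup>2 * b k * (b k - b (Suc k))"
    have X: "v k x ^ 4 \<le> X" for x
      using fourth_power_le_dissipation[OF v_fin[of k]] by (simp add: X_def b_def v_Suc)
    have X0: "0 \<le> X" using b_nonneg[of k] b_decr[of k] by (simp add: X_def)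
    have "v k x \<le> root 4 X" for x
      using X[of x] v_nonneg[of k x] by (metis real_root_le_iff real_root_power_cancel zero_less_numeral)
    from power_mono[OF sup[OF this] b_nonneg, of 4] have "b k ^ 4 \<le> X * \<mu> y ^ 4"
      using X0 by (simp add: power_mult_distrib)
    then have "b k * b k ^ 3 \<le> b k * (A * (b k - b (Suc k)))"
      by (simp add: X_def A_def power_numeral_reduce ac_simps)
    then show ?thesis using False b_nonneg[of k] by (simp add: mult_le_cancel_left)
  next
    case True
    with b_decr[of k] b_nonneg[of "Suc k"] show ?thesis by simp
  qed
  have b_le: "b k \<le> b j" if "j \<le> k" for j k
    using lift_Suc_antimono_le[of b, OF b_decr that] .
  have A_nonneg: "0 \<le> A" by (simp add: A_def)
  have "(k + 1) * b k ^ 3 = (\<Sum>j\<le>k. b k ^ 3)" by simp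
  also have "\<dots> \<le> (\<Sum>j\<le>k. A * (b j - b (Suc j)))"
    using b_le b_nonneg by (intro sum_mono order_trans[OF power_mono cube]) auto
  also have "\<dots> = A * (b 0 - b (Suc k))"
    by (simp only: sum_distrib_left[symmetric] sum_telescope)
  also have "\<dots> \<le> A * b 0"
    using A_nonneg b_nonneg by (intro mult_left_mono) auto
  also have "b 0 = \<mu> y"
    unfolding b_def by (subst total_eq_sum[of "{y}"]) (auto simp: v_def)
  finally have kb: "(k + 1) * b k ^ 3 \<le> A * \<mu> y" .
  have "c * (v k z)\<^sup>2 \<le> (\<Sum>x\<in>{z}. (v k x)\<^sup>2 * \<mu> x)"
    using measure_ge[of z] by (simp add: mult.commute mult_right_mono)
  also have "\<dots> \<le> b k" unfolding b_def by (intro sum_le_total sq_fin) auto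
  finally have "(c * (v k z)\<^sup>2) ^ 3 \<le> b k ^ 3" using c_pos by (intro power_mono) auto
  then have "(k + 1) * (c * (v k z)\<^sup>2) ^ 3 \<le> A * \<mu> y"
    using kb by (meson mult_left_mono of_nat_0_le_iff order_trans)
  also have "\<dots> = 8 / c\<^sup>2 * \<mu> y ^ 5" by (simp add: A_def power_numeral_reduce)
  also have "\<dots> \<le> 8 / c\<^sup>2 * M ^ 5"
    using measure_le[of y] measure_pos[of y] by (intro mult_left_mono power_mono) auto
  finally have "c ^ 3 * ((k + 1) * v k z ^ 6) \<le> c ^ 3 * (8 * (M / c) ^ 5)"
    using c_pos by (simp add: power_mult_distrib power_divide power_numeral_reduce field_simps)
  then show ?thesis using c_pos by (simp add: v_def add.commute)
qed

section \<open>The heat semigroup as a Poisson average of walk powers\<close>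

lemma laplacian_sum:
  "laplacian w (\<lambda>x. \<Sum>i\<in>I. a i * f i x) x = (\<Sum>i\<in>I. a i * laplacian w (f i) x)"
  by (simp add: laplacian_eq transition_sum transition_scale right_diff_distrib sum_subtractf)

text \<open>
  The binomial theorem for \<open>P\<close> as the sum of the identity and the Laplacian.
\<close>

lemma transition_power_binomial:
  "(P ^^ k) u x = (\<Sum>i\<le>k. real (k choose i) * (laplacian w ^^ i) u x)"
proof (induction k arbitrary: x)
  case (Suc k)
  let ?L = "laplacian w"
  have IH: "(P ^^ k) u = (\<lambda>x. \<Sum>i\<le>k. real (k choose i) * (?L ^^ i) u x)" using Suc by blast
  have "(P ^^ Suc k) u x = (P ^^ k) u x + ?L ((P ^^ k) u) x" by (simp add: laplacian_eq)
  also have "\<dots> = (\<Sum>i\<le>Suc k. real (k choose i) * (?L ^^ i) u x)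
      + (\<Sum>i\<le>k. real (k choose i) * (?L ^^ Suc i) u x)"
    unfolding IH laplacian_sum by simp
  also have "\<dots> = (\<Sum>i\<le>Suc k. real (Suc k choose i) * (?L ^^ i) u x)"
    by (subst (1 2) sum.atMost_Suc_shift) (simp add: sum.distrib distrib_right)
  finally show ?case .
qed simp

text \<open>
  On bounded functions the Laplacian has norm at most \<open>2\<close>. The same holds on absolutely summable
  functions (\<open>total_abs_laplacian_power_le\<close>); the two bounds together control the squared norm of
  the remainder of the exponential series.
\<close>

lemma abs_laplacian_power_le: "\<bar>(laplacian w ^^ k) (indicator {y}) x\<bar> \<le> 2 ^ k"
proof (induction k arbitrary: x)
  case (Suc k)
  let ?f = "(laplacian w ^^ k) (indicator {y})"
  have "P (\<lambda>_. - (2 ^ k)) x \<le> P ?f x" "P ?f x \<le> P (\<lambda>_. 2 ^ k) x"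
    using Suc by (auto intro!: transition_mono simp: abs_le_iff minus_le_iff)
  with Suc[of x] show ?case by (simp add: laplacian_eq[of ?f x] transition_const)
qed (auto simp: indicator_def)

lemma fin_supp_laplacian: "fin_supp f \<Longrightarrow> fin_supp (laplacian w f)"
  using fin_supp_diff[OF fin_supp_transition[of f], of f] by (simp add: laplacian_eq[abs_def])

lemma fin_supp_abs: "fin_supp f \<Longrightarrow> fin_supp (\<lambda>x. \<bar>f x\<bar>)"
  by (simp add: fin_supp_def)

lemma fin_supp_laplacian_power: "fin_supp ((laplacian w ^^ k) (indicator {y}))"
  by (induction k) (auto intro: fin_supp_laplacian fin_supp_indicator)

lemma abs_transition_le: "\<bar>P f x\<bar> \<le> P (\<lambda>x. \<bar>f x\<bar>) x"
proof -
  have "P (\<lambda>x. -1 * \<bar>f x\<bar>) x \<le> P f x" "P f x \<le> P (\<lambda>x. \<bar>f x\<bar>) x"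
    by (auto intro!: transition_mono)
  then show ?thesis unfolding transition_scale by simp
qed

lemma total_abs_laplacian_power_le:
  "T (\<lambda>x. \<bar>(laplacian w ^^ k) (indicator {y}) x\<bar>) \<le> 2 ^ k * \<mu> y"
proof (induction k)
  case 0
  then show ?case by (simp add: total_indicator)
next
  case (Suc k)
  let ?f = "(laplacian w ^^ k) (indicator {y})"
  note f = fin_supp_laplacian_power[of k y]
  have fs: "fin_supp (P (\<lambda>x. \<bar>?f x\<bar>))" by (intro fin_supp_transition fin_supp_abs f)
  have neg: "fin_supp (\<lambda>x. - \<bar>?f x\<bar>)" using f by (simp add: fin_supp_def)
  have le: "\<bar>laplacian w ?f x\<bar> \<le> P (\<lambda>x. \<bar>?f x\<bar>) x - - \<bar>?f x\<bar>" for x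
    using abs_transition_le[of ?f x] by (simp add: laplacian_eq)
  have "T (\<lambda>x. \<bar>laplacian w ?f x\<bar>) \<le> T (\<lambda>x. P (\<lambda>x. \<bar>?f x\<bar>) x - - \<bar>?f x\<bar>)"
    by (rule total_mono[OF _ _ le]) (intro fin_supp_abs fin_supp_laplacian fin_supp_diff f fs neg)+
  also have "\<dots> = T (\<lambda>x. \<bar>?f x\<bar>) - T (\<lambda>x. - \<bar>?f x\<bar>)"
    by (subst total_diff[OF fs neg]) (simp add: total_transition fin_supp_abs f)
  also have "T (\<lambda>x. - \<bar>?f x\<bar>) = - T (\<lambda>x. \<bar>?f x\<bar>)"
    by (simp add: total_def infsum_uminus)
  finally show ?case using Suc by simp
qed

text \<open>
  The continuous-time walk makes a Poisson number of steps with mean \<open>t\<close>. The power series of the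
  semigroup converges pointwise and in norm, because its remainder is bounded by the tail \<open>\<tau>\<close> of the
  series of \<open>exp (2 * t)\<close> uniformly, and by a multiple of \<open>\<tau>\<close> in total mass. Norm limits are unique
  because they determine the pointwise limit. Multiplying the series by the one of \<open>exp t\<close>
  turns powers of the Laplacian into powers of \<open>P\<close> by the binomial theorem.
\<close>

lemma heat_semigroup_eq:
  assumes "0 \<le> t"
  shows "heat_semigroup w t (indicator {y}) x
    = exp (- t) * (\<Sum>k. t ^ k / fact k * (P ^^ k) (indicator {y}) x)"
proof -
  let ?u = "indicator {y} :: int ^ 'd \<Rightarrow> real"
  define a where "a k x = t ^ k / fact k * (laplacian w ^^ k) ?u x" for k x
  define g where "g k = (2 * t) ^ k / fact k" for k
  define v where "v x = (\<Sum>k. a k x)" for x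
  define S where "S N x = (\<Sum>k<N. a k x)" for N x
  define \<tau> where "\<tau> N = (\<Sum>k. g (k + N))" for N
  have g_sums: "g sums exp (2 * t)"
    using exp_converges[of "2 * t"] by (simp add: g_def[abs_def] field_simps)
  have g_summable: "summable (\<lambda>k. g (k + N))" for N
    using g_sums by (simp add: sums_iff summable_ignore_initial_segment)
  have \<tau>_lim: "\<tau> \<longlonglongrightarrow> 0"
  proof -
    have "(\<lambda>N. exp (2 * t) - (\<Sum>k<N. g k)) \<longlonglongrightarrow> exp (2 * t) - exp (2 * t)"
      using g_sums by (intro tendsto_intros) (simp add: sums_def)
    moreover have "\<tau> = (\<lambda>N. exp (2 * t) - (\<Sum>k<N. g k))"
      unfolding \<tau>_def using suminf_minus_initial_segment[of g] g_sums by (auto simp: sums_iff)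
    ultimately show ?thesis by simp
  qed
  have a_le: "\<bar>a k x\<bar> \<le> g k" for k x
    using abs_laplacian_power_le[of k y x] assms
    by (simp add: a_def g_def abs_mult power_mult_distrib divide_right_mono mult.commute mult_left_mono)
  have a_total: "(\<Sum>x\<in>F. \<bar>a k x\<bar> * \<mu> x) \<le> g k * \<mu> y" if "finite F" for F k
  proof -
    have "(\<Sum>x\<in>F. \<bar>a k x\<bar> * \<mu> x) = t ^ k / fact k * (\<Sum>x\<in>F. \<bar>(laplacian w ^^ k) ?u x\<bar> * \<mu> x)"
      using assms by (simp add: a_def abs_mult sum_distrib_left mult.assoc)
    also have "\<dots> \<le> t ^ k / fact k * T (\<lambda>x. \<bar>(laplacian w ^^ k) ?u x\<bar>)"
      using assms that by (intro mult_left_mono sum_le_total fin_supp_abs fin_supp_laplacian_power) auto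
    also have "\<dots> \<le> t ^ k / fact k * (2 ^ k * \<mu> y)"
      using assms by (intro mult_left_mono total_abs_laplacian_power_le) auto
    finally show ?thesis by (simp add: g_def power_mult_distrib ac_simps)
  qed
  have a_summable: "summable (\<lambda>k. \<bar>a (k + N) x\<bar>)" for N x
    by (rule summable_comparison_test'[OF g_summable[of N], of 0]) (use a_le in auto)
  have rem: "v x - S N x = (\<Sum>k. a (k + N) x)" for N x
    using suminf_minus_initial_segment[of "\<lambda>k. a k x" N] a_summable[of 0 x]
    by (simp add: v_def S_def summable_rabs_cancel)
  have rem_le_sum: "\<bar>v x - S N x\<bar> \<le> (\<Sum>k. \<bar>a (k + N) x\<bar>)" for N x
    unfolding rem by (rule summable_rabs[OF a_summable])
  have rem_le: "\<bar>v x - S N x\<bar> \<le> \<tau> N" for N x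
    unfolding \<tau>_def by (rule order_trans[OF rem_le_sum suminf_le[OF a_le a_summable g_summable]])
  have rem_total: "(\<Sum>x\<in>F. \<bar>v x - S N x\<bar> * \<mu> x) \<le> \<tau> N * \<mu> y" if F: "finite F" for F N
  proof -
    have "(\<Sum>x\<in>F. \<bar>v x - S N x\<bar> * \<mu> x) \<le> (\<Sum>x\<in>F. (\<Sum>k. \<bar>a (k + N) x\<bar>) * \<mu> x)"
      using less_imp_le[OF measure_pos] by (intro sum_mono mult_right_mono rem_le_sum)
    also have "\<dots> = (\<Sum>x\<in>F. \<Sum>k. \<bar>a (k + N) x\<bar> * \<mu> x)"
      by (simp add: suminf_mult2 a_summable)
    also have "\<dots> = (\<Sum>k. \<Sum>x\<in>F. \<bar>a (k + N) x\<bar> * \<mu> x)"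
      by (rule suminf_sum[symmetric]) (intro summable_mult2 a_summable)
    also have "\<dots> \<le> (\<Sum>k. g (k + N) * \<mu> y)"
      by (intro suminf_le a_total F summable_sum summable_mult2 a_summable g_summable)
    finally show ?thesis by (simp add: \<tau>_def suminf_mult2[OF g_summable])
  qed
  have \<tau>_nonneg: "0 \<le> \<tau> N" for N
    using rem_le[of y N] by linarith
  (* The squared norm of the remainder is at most its supremum times its total mass. *)
  have rem_sq: "(\<Sum>x\<in>F. \<bar>v x - S N x\<bar>\<^sup>2 * \<mu> x) \<le> (\<tau> N)\<^sup>2 * \<mu> y" if F: "finite F" for F N
  proof -
    have "(\<Sum>x\<in>F. \<bar>v x - S N x\<bar>\<^sup>2 * \<mu> x) \<le> (\<Sum>x\<in>F. \<tau> N * (\<bar>v x - S N x\<bar> * \<mu> x))"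
    proof (rule sum_mono)
      fix x
      have "\<bar>v x - S N x\<bar> * (\<bar>v x - S N x\<bar> * \<mu> x) \<le> \<tau> N * (\<bar>v x - S N x\<bar> * \<mu> x)"
        using less_imp_le[OF measure_pos[of x]] by (intro mult_right_mono rem_le mult_nonneg_nonneg) auto
      then show "\<bar>v x - S N x\<bar>\<^sup>2 * \<mu> x \<le> \<tau> N * (\<bar>v x - S N x\<bar> * \<mu> x)"
        by (simp only: power2_eq_square mult.assoc)
    qed
    also have "\<dots> \<le> \<tau> N * (\<tau> N * \<mu> y)"
      unfolding sum_distrib_left[symmetric] by (intro mult_left_mono rem_total F \<tau>_nonneg)
    finally show ?thesis by (simp add: power2_eq_square)
  qed
  have rem_ell2: "(\<lambda>x. v x - S N x) \<in> ell2 w" for N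
    unfolding ell2_def using rem_sq less_imp_le[OF measure_pos]
    by (auto intro!: nonneg_bdd_above_summable_on bdd_aboveI2[where M = "(\<tau> N)\<^sup>2 * \<mu> y"])
  have v_ell2: "v \<in> ell2 w" using rem_ell2[of 0] by (simp add: S_def)
  have v_lim: "(\<lambda>N. ell2_norm w (\<lambda>x. v x - S N x)) \<longlonglongrightarrow> 0"
  proof (rule tendsto_sandwich[OF _ _ tendsto_const])
    show "\<forall>\<^sub>F N in sequentially. ell2_norm w (\<lambda>x. v x - S N x) \<le> \<tau> N * sqrt (\<mu> y)"
    proof (intro always_eventually allI)
      fix N
      have "(\<Sum>\<^sub>\<infinity>x. \<bar>v x - S N x\<bar>\<^sup>2 * \<mu> x) \<le> (\<tau> N)\<^sup>2 * \<mu> y"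
        using rem_ell2[of N] by (intro infsum_le_finite_sums rem_sq) (auto simp: ell2_def)
      then have "ell2_norm w (\<lambda>x. v x - S N x) \<le> sqrt ((\<tau> N)\<^sup>2 * \<mu> y)"
        unfolding ell2_norm_def by simp
      then show "ell2_norm w (\<lambda>x. v x - S N x) \<le> \<tau> N * sqrt (\<mu> y)"
        using \<tau>_nonneg[of N] by (simp add: real_sqrt_mult)
    qed
    show "(\<lambda>N. \<tau> N * sqrt (\<mu> y)) \<longlonglongrightarrow> 0"
      using tendsto_mult_right[OF \<tau>_lim, of "sqrt (\<mu> y)"] by simp
    show "\<forall>\<^sub>F N in sequentially. 0 \<le> ell2_norm w (\<lambda>x. v x - S N x)"
      unfolding ell2_norm_def using less_imp_le[OF measure_pos]
      by (intro always_eventually allI real_sqrt_ge_zero infsum_nonneg) simp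
  qed
  (* A norm limit is a pointwise limit, since single terms of the squared norm are
     bounded by the whole; the remainder is square-summable because the partial sums
     are finitely supported. *)
  have unique: "v' = v" if v': "v' \<in> ell2 w" "(\<lambda>N. ell2_norm w (\<lambda>x. v' x - S N x)) \<longlonglongrightarrow> 0" for v'
  proof
    fix x
    have diff_ell2: "(\<lambda>x. \<bar>v' x - S N x\<bar>\<^sup>2 * \<mu> x) summable_on UNIV" for N
    proof -
      let ?F = "\<Union>k<N. {x. (laplacian w ^^ k) ?u x \<noteq> 0}"
      have fin: "finite ?F" using fin_supp_laplacian_power by (auto simp: fin_supp_def)
      have "(\<lambda>x. \<bar>v' x\<bar>\<^sup>2 * \<mu> x) summable_on (- ?F)"
        using v'(1) by (auto simp: ell2_def intro: summable_on_subset_banach[OF _ subset_UNIV])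
      moreover have "S N x = 0" if "x \<in> - ?F" for x
        using that unfolding S_def a_def by (intro sum.neutral) auto
      ultimately have "(\<lambda>x. \<bar>v' x - S N x\<bar>\<^sup>2 * \<mu> x) summable_on (- ?F)"
        by (subst summable_on_cong[where g = "\<lambda>x. \<bar>v' x\<bar>\<^sup>2 * \<mu> x"]) simp_all
      then have "(\<lambda>x. \<bar>v' x - S N x\<bar>\<^sup>2 * \<mu> x) summable_on (- ?F \<union> ?F)"
        by (rule summable_on_Un_disjoint[OF _ summable_on_finite[OF fin]]) auto
      then show ?thesis by (simp only: Compl_partition2)
    qed
    have "\<bar>v' x - S N x\<bar> * sqrt (\<mu> x) \<le> ell2_norm w (\<lambda>x. v' x - S N x)" for N
    proof -
      have "(\<Sum>x\<in>{x}. \<bar>v' x - S N x\<bar>\<^sup>2 * \<mu> x) \<le> (\<Sum>\<^sub>\<infinity>x. \<bar>v' x - S N x\<bar>\<^sup>2 * \<mu> x)"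
        using less_imp_le[OF measure_pos] by (intro finite_sum_le_infsum diff_ell2) auto
      then have "sqrt (\<bar>v' x - S N x\<bar>\<^sup>2 * \<mu> x) \<le> ell2_norm w (\<lambda>x. v' x - S N x)"
        unfolding ell2_norm_def by simp
      then show ?thesis by (simp add: real_sqrt_mult)
    qed
    then have "(\<lambda>N. \<bar>v' x - S N x\<bar> * sqrt (\<mu> x)) \<longlonglongrightarrow> 0"
      using measure_pos[of x]
      by (intro tendsto_sandwich[OF _ _ tendsto_const v'(2)]) (auto intro: less_imp_le)
    from tendsto_mult_right[OF this, of "1 / sqrt (\<mu> x)"]
    have "(\<lambda>N. v' x - S N x) \<longlonglongrightarrow> 0"
      using measure_pos[of x] by (simp add: tendsto_rabs_zero_iff)
    from tendsto_diff[OF tendsto_const[of "v' x"] this] have "(\<lambda>N. S N x) \<longlonglongrightarrow> v' x" by simp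
    moreover have "(\<lambda>N. S N x) \<longlonglongrightarrow> v x"
      unfolding S_def v_def using a_summable[of 0 x]
      by (intro summable_LIMSEQ) (simp add: summable_rabs_cancel)
    ultimately show "v' x = v x" by (rule LIMSEQ_unique)
  qed
  have sem: "heat_semigroup w t ?u = v"
    unfolding heat_semigroup_def
  proof (rule the_equality)
    show "v \<in> ell2 w \<and> (\<lambda>N. ell2_norm w (\<lambda>x. v x - (\<Sum>k<N. t ^ k / fact k * (laplacian w ^^ k) ?u x)))
        \<longlonglongrightarrow> 0"
      using v_ell2 v_lim[unfolded S_def a_def] by (rule conjI)
  next
    fix v' assume "v' \<in> ell2 w \<and> (\<lambda>N. ell2_norm w (\<lambda>x. v' x - (\<Sum>k<N. t ^ k / fact k * (laplacian w ^^ k) ?u x)))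
        \<longlonglongrightarrow> 0"
    then show "v' = v"
      by (intro unique[unfolded S_def a_def]) (rule conjunct1, assumption, rule conjunct2, assumption)
  qed
  have exp_summable: "summable (\<lambda>k. norm (t ^ k / fact k))"
    using summable_norm_exp[of t] by (simp add: field_simps)
  (* Cauchy product of the series of v x with the exponential series. *)
  have "(\<lambda>k. \<Sum>i\<le>k. a i x * (t ^ (k - i) / fact (k - i))) sums (v x * (\<Sum>k. t ^ k / fact k))"
    unfolding v_def using a_summable[of 0 x] by (intro Cauchy_product_sums exp_summable) simp
  moreover have "(\<Sum>i\<le>k. a i x * (t ^ (k - i) / fact (k - i))) = t ^ k / fact k * (P ^^ k) ?u x" for k
    unfolding transition_power_binomial sum_distrib_left
  proof (intro sum.cong refl)
    fix i assume "i \<in> {..k}"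
    then have i: "i \<le> k" by simp
    have "t ^ k = t ^ i * t ^ (k - i)" using i by (simp flip: power_add)
    then show "a i x * (t ^ (k - i) / fact (k - i))
        = t ^ k / fact k * (real (k choose i) * (laplacian w ^^ i) ?u x)"
      by (simp add: a_def binomial_fact[OF i] field_simps)
  qed
  moreover have "(\<Sum>k. t ^ k / fact k) = exp t"
    using exp_converges[of t] by (simp add: sums_iff field_simps)
  ultimately have "(\<Sum>k. t ^ k / fact k * (P ^^ k) ?u x) = v x * exp t" by (simp add: sums_iff)
  then show ?thesis by (simp add: sem exp_minus field_simps)
qed

end

section \<open>Bounds for Poisson averages and auxiliary integrals\<close>

lemma exp_series_sums: "(\<lambda>k. t ^ k / fact k) sums exp (t::real)"
  using exp_converges[of t] by (simp add: field_simps)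

lemma summable_exp_series_bounded:
  fixes t :: real
  assumes "\<And>k. \<bar>q k\<bar> \<le> C"
  shows "summable (\<lambda>k. t ^ k / fact k * q k)"
proof (rule summable_comparison_test')
  show "summable (\<lambda>k. \<bar>t\<bar> ^ k / fact k * C)"
    using exp_series_sums[of "\<bar>t\<bar>"] by (intro summable_mult2) (simp add: sums_iff)
  show "norm (t ^ k / fact k * q k) \<le> \<bar>t\<bar> ^ k / fact k * C" for k
    using assms[of k] by (simp add: abs_mult power_abs divide_right_mono mult_left_mono)
qed

text \<open>
  A Poisson variable \<open>N\<close> of mean \<open>t\<close> is rarely much smaller than \<open>t\<close>. The only quantitative input
  is that the mean of \<open>1 / (N + 1)\<close> is at most \<open>1 / t\<close>: if \<open>k + 1 \<ge> sqrt t\<close>, the decay of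
  \<open>q\<close> gives \<open>q k \<le> D\<close>, and otherwise \<open>q k \<le> 1 \<le> sqrt t / (k + 1)\<close>.
\<close>

lemma poisson_average_le:
  fixes t :: real
  assumes t: "1 \<le> t" and q: "\<And>k. 0 \<le> q k" "\<And>k. q k \<le> 1"
    and decay: "\<And>k. (k + 1) * q k ^ 6 \<le> C"
  shows "exp (- t) * (\<Sum>k. t ^ k / fact k * q k) \<le> (C powr (1/6) + 1) * t powr (- 1/12)"
proof -
  have t0: "0 < t" using t by simp
  define D where "D = C powr (1/6) * t powr (- 1/12)"
  have C0: "0 \<le> C" using decay[of 0] q(1)[of 0] by (metis order_trans mult_nonneg_nonneg of_nat_0_le_iff zero_le_power)
  have q_le: "q k \<le> D + sqrt t / (k + 1)" for k
  proof (cases "sqrt t \<le> k + 1")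
    case True
    have "sqrt t * q k ^ 6 \<le> C"
      using mult_right_mono[OF True, of "q k ^ 6"] q(1)[of k] decay[of k] by simp
    then have "q k ^ 6 \<le> C / sqrt t" using t0 by (simp add: field_simps)
    then have "(q k ^ 6) powr (1/6) \<le> (C / sqrt t) powr (1/6)"
      using q(1)[of k] by (intro powr_mono2) auto
    also have "(q k ^ 6) powr (1/6) = q k"
      using q(1)[of k] by (cases "q k = 0") (simp_all add: powr_powr flip: powr_numeral)
    also have "(C / sqrt t) powr (1/6) = D"
      using t0 C0 by (simp add: D_def powr_divide powr_half_sqrt[symmetric] powr_powr powr_minus_divide)
    finally show ?thesis using t0 by (simp add: add_increasing2)
  next
    case False
    then have "1 \<le> sqrt t / (k + 1)" by (simp add: field_simps)
    moreover have "0 \<le> D" by (simp add: D_def)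
    ultimately show ?thesis using q(2)[of k] by linarith
  qed
  have s2: "(\<lambda>k. t ^ k / fact k * (1 / (real k + 1))) sums ((exp t - 1) / t)"
  proof -
    have "(\<lambda>k. t ^ Suc k / fact (Suc k)) sums (exp t - 1)"
      using exp_series_sums[of t] by (subst sums_Suc_iff) simp
    moreover have "t ^ Suc k / fact (Suc k) / t = t ^ k / fact k * (1 / (real k + 1))" for k
      using t0 by (simp add: add.commute)
    ultimately show ?thesis by (metis (no_types, lifting) sums_cong sums_divide)
  qed
  have s1: "(\<lambda>k. t ^ k / fact k * D) sums (exp t * D)"
    by (intro sums_mult2 exp_series_sums)
  have "(\<lambda>k. t ^ k / fact k * D + sqrt t * (t ^ k / fact k * (1 / (real k + 1)))) sums
      (exp t * D + sqrt t * ((exp t - 1) / t))"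
    by (intro sums_add sums_mult s1 s2)
  moreover have "summable (\<lambda>k. t ^ k / fact k * q k)"
    using q by (intro summable_exp_series_bounded[of _ 1]) auto
  moreover have "t ^ k / fact k * q k
      \<le> t ^ k / fact k * D + sqrt t * (t ^ k / fact k * (1 / (real k + 1)))" for k
    using mult_left_mono[OF q_le[of k], of "t ^ k / fact k"] t0 by (simp add: algebra_simps)
  ultimately have "(\<Sum>k. t ^ k / fact k * q k) \<le> exp t * D + sqrt t * ((exp t - 1) / t)"
    by (metis (no_types, lifting) sums_iff suminf_le)
  also have "\<dots> \<le> exp t * (D + sqrt t / t)"
    using t0 by (simp add: field_simps)
  also have "sqrt t / t = t powr (- 1/2)"
    using t0 by (simp add: powr_half_sqrt[symmetric] powr_minus_divide field_simps flip: powr_add)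
  also have "t powr (- 1/2) \<le> t powr (- 1/12)" using t by (intro powr_mono) auto
  finally have "(\<Sum>k. t ^ k / fact k * q k) \<le> exp t * ((C powr (1/6) + 1) * t powr (- 1/12))"
    by (simp add: D_def algebra_simps)
  then show ?thesis by (simp add: exp_minus field_simps)
qed

text \<open>
  An affine lower bound in \<open>k\<close> is averaged to the same affine function of the mean \<open>t\<close>.
\<close>

lemma poisson_average_ge:
  fixes t :: real
  assumes t: "0 \<le> t" and q: "\<And>k. m - k * \<beta> \<le> q k" and s: "summable (\<lambda>k. t ^ k / fact k * q k)"
  shows "m - t * \<beta> \<le> exp (- t) * (\<Sum>k. t ^ k / fact k * q k)"
proof -
  have mean: "(\<lambda>k. t ^ k / fact k * k) sums (t * exp t)"
  proof -
    have "(\<lambda>k. t ^ Suc k / fact (Suc k) * Suc k) = (\<lambda>k. t * (t ^ k / fact k))"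
      by (auto simp: field_simps simp del: of_nat_Suc)
    then have "(\<lambda>k. t ^ Suc k / fact (Suc k) * Suc k) sums (t * exp t)"
      using sums_mult[OF exp_series_sums[of t], of t] by simp
    then show ?thesis by (subst (asm) sums_Suc_iff) simp
  qed
  have total: "(\<lambda>k. t ^ k / fact k * m - t ^ k / fact k * k * \<beta>) sums (exp t * m - t * exp t * \<beta>)"
    by (intro sums_diff sums_mult2 mean exp_series_sums)
  have term_le: "t ^ k / fact k * m - t ^ k / fact k * k * \<beta> \<le> t ^ k / fact k * q k" for k
    using mult_left_mono[OF q[of k], of "t ^ k / fact k"] t by (simp add: right_diff_distrib mult.assoc)
  have "exp t * m - t * exp t * \<beta> \<le> (\<Sum>k. t ^ k / fact k * q k)"
    by (rule sums_le[OF term_le total summable_sums[OF s]])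
  then have "exp t * (m - t * \<beta>) \<le> (\<Sum>k. t ^ k / fact k * q k)"
    by (simp add: algebra_simps)
  then show ?thesis by (simp add: exp_minus field_simps)
qed

lemma integral_inverse_Icc:
  assumes "1 \<le> (R::real)"
  shows "set_integrable lborel {1..R} (\<lambda>t. 1 / t)" "(LINT t:{1..R}|lborel. 1 / t) = ln R"
proof -
  have "has_bochner_integral lborel (\<lambda>t. 1 / t * indicator {1..R} t) (ln R - ln 1)"
    using assms by (intro has_bochner_integral_FTC_Icc_nonneg) (auto intro!: derivative_eq_intros)
  then show "set_integrable lborel {1..R} (\<lambda>t. 1 / t)" "(LINT t:{1..R}|lborel. 1 / t) = ln R"
    by (auto simp: has_bochner_integral_iff set_integrable_def set_lebesgue_integral_def mult.commute)
qed

lemma set_integral_sum: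
  fixes f :: "'i \<Rightarrow> 'a \<Rightarrow> real"
  assumes "\<And>i. i \<in> I \<Longrightarrow> set_integrable N A (f i)"
  shows "set_integrable N A (\<lambda>x. \<Sum>i\<in>I. f i x)"
    "(LINT x:A|N. (\<Sum>i\<in>I. f i x)) = (\<Sum>i\<in>I. LINT x:A|N. f i x)"
  using assms unfolding set_integrable_def set_lebesgue_integral_def
  by (simp_all add: sum_distrib_left)

lemma set_integrable_powr_Ici:
  fixes e :: real
  assumes "e < - 1"
  shows "set_integrable lborel {1..} (\<lambda>t. t powr e)"
proof -
  have "(\<lambda>t. t powr e) integrable_on {1..}"
    using has_integral_powr_to_inf[OF assms, of 1] by (auto simp: integrable_on_def)
  then have "set_integrable lebesgue {1..} (\<lambda>t. t powr e)"
    by (intro nonnegative_absolutely_integrable_1) auto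
  then show ?thesis
    unfolding set_integrable_def by (subst (asm) integrable_completion) auto
qed

context lattice_weights
begin

section \<open>The kernel on finite sets with small boundary\<close>

lemma indicator_power_bounds:
  "0 \<le> (P ^^ k) (indicator B) x" "(P ^^ k) (indicator B) x \<le> 1"
  using transition_power_bounds[of "indicator B" k x] by (auto simp: indicator_def)

text \<open>
  The decay of the walk bounds the integrand by a multiple of \<open>t powr (- 13/12)\<close>. Lower bounds for
  the kernel depend on this convergence, because the Bochner integral of a function that is not
  integrable is \<open>0\<close> by convention.
\<close>

lemma heat_integrable:
  "set_integrable lborel {1..} (\<lambda>t. heat_semigroup w t (indicator {y}) x / t)"
proof -
  define q where "q k = (P ^^ k) (indicator {y}) x" for k
  define C where "C = 8 * (M / c) ^ 5"
  let ?h = "\<lambda>t::real. exp (- t) * (\<Sum>k. t ^ k / fact k * q k)"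
  note q01 = indicator_power_bounds[of _ "{y}" x, folded q_def]
  have "set_integrable lborel {1..} (\<lambda>t. (C powr (1/6) + 1) * t powr (- 13/12))"
    by (intro set_integrable_mult_right set_integrable_powr_Ici) simp
  then have "set_integrable lborel {1..} (\<lambda>t. ?h t / t)"
  proof (rule set_integrable_bound)
    show "AE t in lborel. t \<in> {1..} \<longrightarrow> norm (?h t / t) \<le> norm ((C powr (1/6) + 1) * t powr (- 13/12))"
    proof (intro always_eventually allI impI)
      fix t :: real assume "t \<in> {1..}"
      then have t: "1 \<le> t" by simp
      have "0 \<le> ?h t"
        using t q01 by (intro mult_nonneg_nonneg suminf_nonneg summable_exp_series_bounded[of _ 1]) auto
      moreover have "?h t / t \<le> (C powr (1/6) + 1) * t powr (- 1/12) / t"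
        using t q01 transition_power_decay[of _ y x]
        by (intro divide_right_mono poisson_average_le) (auto simp: q_def C_def add.commute)
      moreover have "(C powr (1/6) + 1) * t powr (- 1/12) / t = (C powr (1/6) + 1) * t powr (- 13/12)"
        using t powr_diff[of t "-1/12" 1] by simp
      ultimately show "norm (?h t / t) \<le> norm ((C powr (1/6) + 1) * t powr (- 13/12))"
        using t by simp
    qed
  qed (simp add: set_borel_measurable_def)
  then show ?thesis
    by (rule set_integrable_cong[THEN iffD1, rotated -1]) (auto simp: heat_semigroup_eq q_def)
qed

lemma W_kernel_eq:
  "W_kernel w x y = (LINT t:{1..}|lborel. \<mu> x * heat_semigroup w t (indicator {y}) x / t)"
proof -
  have "(LINT t:{1..}|lborel. heat_kernel w t x y / t)
      = (LINT t:{1..}|lborel. 1 / \<mu> y * (heat_semigroup w t (indicator {y}) x / t))"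
    by (simp add: heat_kernel_def ac_simps)
  then show ?thesis
    using measure_pos[of y] unfolding W_kernel_def
    by (simp only: set_integral_mult_right times_divide_eq_right[symmetric]) simp
qed

text \<open>
  The probability that the walk is in \<open>B\<close> after \<open>k\<close> steps when it starts in \<open>B\<close>, not normalized.
\<close>

definition overlap where
  "overlap B k = T (\<lambda>x. indicator B x * (P ^^ k) (indicator B) x)"

lemma overlap_eq_sum:
  assumes "finite B"
  shows "overlap B k = (\<Sum>x\<in>B. \<Sum>y\<in>B. \<mu> x * (P ^^ k) (indicator {y}) x)"
proof -
  have ind: "indicator B x = (\<Sum>y\<in>B. indicator {y} x :: real)" for x
    using assms by (simp add: indicator_def)
  have "(P ^^ k) (indicator B) x = (\<Sum>y\<in>B. (P ^^ k) (indicator {y}) x)" for x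
  proof (induction k arbitrary: x)
    case (Suc k)
    then have "(P ^^ k) (indicator B) = (\<lambda>x. \<Sum>y\<in>B. (P ^^ k) (indicator {y}) x)" by blast
    then show ?case by (simp add: transition_sum)
  qed (simp add: ind)
  then show ?thesis
    unfolding overlap_def
    by (subst total_eq_sum[OF assms]) (auto simp: sum_distrib_left mult.commute intro!: sum.cong)
qed

text \<open>
  In each step the overlap drops by at most the measure of the boundary \<open>B - I\<close>. By self-adjointness
  the drop is the total of \<open>(1\<^sub>B - P 1\<^sub>B) * P\<^sup>k 1\<^sub>B\<close>; here the first factor vanishes on \<open>I\<close>, is at most
  \<open>1\<close> on \<open>B\<close> and is not positive elsewhere, while the second one lies between \<open>0\<close> and \<open>1\<close>.
\<close>

lemma overlap_ge:
  assumes B: "finite B" and I: "\<And>x y. x \<in> I \<Longrightarrow> adj x y \<Longrightarrow> y \<in> B"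
  shows "(\<Sum>x\<in>B. \<mu> x) - k * (\<Sum>x\<in>B - I. \<mu> x) \<le> overlap B k"
proof (induction k)
  case 0
  show ?case unfolding overlap_def by (subst total_eq_sum[OF B]) auto
next
  case (Suc k)
  let ?u = "indicator B :: _ \<Rightarrow> real" and ?v = "(P ^^ k) (indicator B)"
  have u: "fin_supp ?u" by (rule fin_supp_indicator[OF B])
  have v: "fin_supp ?v" by (rule fin_supp_transition_power[OF u])
  have uv: "fin_supp (\<lambda>x. ?u x * ?v x)" "fin_supp (\<lambda>x. P ?u x * ?v x)"
    by (intro fin_supp_mult u fin_supp_transition)+
  have "overlap B k - overlap B (Suc k) = T (\<lambda>x. ?u x * ?v x) - T (\<lambda>x. P ?u x * ?v x)"
    by (simp add: overlap_def transition_selfadjoint[OF u v])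
  also have "\<dots> = T (\<lambda>x. ?u x * ?v x - P ?u x * ?v x)"
    by (rule total_diff[OF uv, symmetric])
  also have "\<dots> \<le> T (indicator (B - I))"
  proof (rule total_mono)
    fix x
    have Pu: "0 \<le> P ?u x" "P ?u x \<le> 1" using indicator_power_bounds[of 1 B x] by simp_all
    have v01: "0 \<le> ?v x" "?v x \<le> 1" by (rule indicator_power_bounds)+
    have "P ?u x = 1" if "x \<in> I"
    proof -
      have "P ?u x = P (\<lambda>_. 1) x"
        unfolding transition_def using I[OF that] by (intro arg_cong2[of _ _ _ _ "(/)"] sum.cong) auto
      then show ?thesis by (simp add: transition_const)
    qed
    then consider "P ?u x = 1" | "x \<in> B - I" | "x \<notin> B" by blast
    then show "?u x * ?v x - P ?u x * ?v x \<le> indicator (B - I) x"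
    proof cases
      case 1
      then show ?thesis using v01 by (auto simp: indicator_def)
    next
      case 2
      with v01 mult_nonneg_nonneg[OF Pu(1) v01(1)] show ?thesis by simp
    next
      case 3
      then show ?thesis using v01 Pu by simp
    qed
  qed (intro fin_supp_diff uv fin_supp_indicator finite_Diff B)+
  also have "\<dots> = (\<Sum>x\<in>B - I. \<mu> x)"
    by (subst total_eq_sum[of "B - I"]) (use B in auto)
  finally show ?case using Suc by (simp add: algebra_simps)
qed

text \<open>
  The sum of the kernel over \<open>B \<times> B\<close> is the integral of \<open>F t\<close>, the Poisson average of the overlaps
  divided by \<open>t\<close>. As the overlap decreases at most linearly, the average stays above half the
  measure of \<open>B\<close> up to the time \<open>R\<close>; the rest of the integral is discarded because it is not negative.
\<close>

lemma sum_W_kernel_ge: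
  assumes B: "finite B" and I: "\<And>x y. x \<in> I \<Longrightarrow> adj x y \<Longrightarrow> y \<in> B"
    and R: "1 \<le> R" "R * (\<Sum>x\<in>B - I. \<mu> x) \<le> (\<Sum>x\<in>B. \<mu> x) / 2"
  shows "(\<Sum>x\<in>B. \<mu> x) / 2 * ln R \<le> (\<Sum>x\<in>B. \<Sum>y\<in>B. W_kernel w x y)"
proof -
  define m where "m = (\<Sum>x\<in>B. \<mu> x)"
  define \<beta> where "\<beta> = (\<Sum>x\<in>B - I. \<mu> x)"
  define F where "F t = (\<Sum>x\<in>B. \<Sum>y\<in>B. \<mu> x * heat_semigroup w t (indicator {y}) x / t)" for t
  have \<beta>_nonneg: "0 \<le> \<beta>" unfolding \<beta>_def by (intro sum_nonneg less_imp_le measure_pos)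
  have int: "set_integrable lborel {1..} (\<lambda>t. \<mu> x * heat_semigroup w t (indicator {y}) x / t)" for x y
    using set_integrable_mult_right[OF heat_integrable, of "\<mu> x" y x] by simp
  have F_int: "set_integrable lborel {1..} F"
    unfolding F_def by (intro set_integral_sum int)
  have W: "(\<Sum>x\<in>B. \<Sum>y\<in>B. W_kernel w x y) = (LINT t:{1..}|lborel. F t)"
    unfolding F_def W_kernel_eq by (simp add: set_integral_sum int)
  have s: "summable (\<lambda>k. t ^ k / fact k * (P ^^ k) (indicator {y}) x)" for x y and t :: real
    using indicator_power_bounds[of _ "{y}" x] by (intro summable_exp_series_bounded[of _ 1]) auto
  have F_eq: "F t = exp (- t) * (\<Sum>k. t ^ k / fact k * overlap B k) / t"
    and ov_summable: "summable (\<lambda>k. t ^ k / fact k * overlap B k)" if "0 \<le> t" for t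
  proof -
    have "(\<lambda>k. \<Sum>x\<in>B. \<Sum>y\<in>B. \<mu> x * (t ^ k / fact k * (P ^^ k) (indicator {y}) x)) sums
      (\<Sum>x\<in>B. \<Sum>y\<in>B. \<mu> x * (\<Sum>k. t ^ k / fact k * (P ^^ k) (indicator {y}) x))"
      by (intro sums_sum sums_mult summable_sums s)
    then have "(\<lambda>k. t ^ k / fact k * overlap B k) sums
      (\<Sum>x\<in>B. \<Sum>y\<in>B. \<mu> x * (\<Sum>k. t ^ k / fact k * (P ^^ k) (indicator {y}) x))"
      by (simp add: overlap_eq_sum[OF B] sum_distrib_left ac_simps)
    then show "F t = exp (- t) * (\<Sum>k. t ^ k / fact k * overlap B k) / t"
      "summable (\<lambda>k. t ^ k / fact k * overlap B k)"
      using that by (auto simp: sums_iff F_def heat_semigroup_eq sum_distrib_left sum_divide_distrib ac_simps)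
  qed
  have ov_nonneg: "0 \<le> overlap B k" for k
    unfolding overlap_def using indicator_power_bounds by (intro total_nonneg) auto
  have F_ge: "m / 2 * (1 / t) \<le> F t" if t: "t \<in> {1..R}" for t
  proof -
    have "m / 2 \<le> m - t * \<beta>"
      using R(2) mult_right_mono[of t R \<beta>] t \<beta>_nonneg by (simp add: m_def \<beta>_def)
    also have "\<dots> \<le> exp (- t) * (\<Sum>k. t ^ k / fact k * overlap B k)"
      using t overlap_ge[OF B I] by (intro poisson_average_ge ov_summable) (auto simp: m_def \<beta>_def)
    finally have "m / 2 / t \<le> exp (- t) * (\<Sum>k. t ^ k / fact k * overlap B k) / t"
      using t by (intro divide_right_mono) auto
    then show ?thesis using t by (simp add: F_eq)
  qed
  have F_nonneg: "0 \<le> F t" if "1 \<le> t" for t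
  proof -
    have "0 \<le> (\<Sum>k. t ^ k / fact k * overlap B k)"
      using that ov_nonneg by (intro suminf_nonneg ov_summable mult_nonneg_nonneg) auto
    then show ?thesis using that by (simp add: F_eq)
  qed
  have "m / 2 * ln R = (LINT t:{1..R}|lborel. m / 2 * (1 / t))"
    by (simp only: set_integral_mult_right integral_inverse_Icc[OF R(1)])
  also have "\<dots> \<le> (LINT t:{1..R}|lborel. F t)"
  proof (rule set_integral_mono)
    show "set_integrable lborel {1..R} (\<lambda>t. m / 2 * (1 / t))"
      by (rule set_integrable_mult_right, rule integral_inverse_Icc(1)[OF R(1)])
    show "set_integrable lborel {1..R} F"
      by (rule set_integrable_subset[OF F_int]) auto
  qed (rule F_ge)
  also have "\<dots> \<le> (LINT t:{1..}|lborel. F t)"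
    using F_int set_integrable_subset[OF F_int, of "{1..R}"] F_nonneg
    unfolding set_lebesgue_integral_def set_integrable_def
    by (intro integral_mono) (auto simp: indicator_def)
  finally show ?thesis unfolding W m_def .
qed

end

section \<open>Cubes and the test functions\<close>

text \<open>
  The cube is half open, so that its cardinality is a power of \<open>b - a\<close>, also when it is empty.
\<close>

definition cube :: "int \<Rightarrow> int \<Rightarrow> (int ^ 'd) set" where
  "cube a b = {x. \<forall>i. a \<le> x $ i \<and> x $ i < b}"

lemma cube_card: "finite (cube a b :: (int ^ 'd) set)"
  "card (cube a b :: (int ^ 'd) set) = nat (b - a) ^ CARD('d)"
proof -
  have eq: "(cube a b :: (int ^ 'd) set) = vec_lambda ` (PiE UNIV (\<lambda>_. {a..<b}))"
    by (auto simp: cube_def image_iff intro!: bexI[of _ "vec_nth _"])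
  have "inj_on (vec_lambda :: _ \<Rightarrow> int ^ 'd) (PiE UNIV (\<lambda>_. {a..<b}))"
    by (rule inj_onI) (metis vec_lambda_inverse UNIV_I)
  then show "card (cube a b :: (int ^ 'd) set) = nat (b - a) ^ CARD('d)"
    unfolding eq by (subst card_image) (auto simp: card_PiE)
  show "finite (cube a b :: (int ^ 'd) set)"
    unfolding eq by (intro finite_imageI finite_PiE) auto
qed

lemma adj_cube:
  assumes "x \<in> cube a b" "adj x y"
  shows "y \<in> cube (a - 1) (b + 1)"
proof -
  have "\<bar>x $ i - y $ i\<bar> \<le> 1" for i
    using member_le_sum[of i UNIV "\<lambda>i. \<bar>x $ i - y $ i\<bar>"] assms(2) by (simp add: adj_def)
  with assms(1) show ?thesis
    unfolding cube_def by (smt (verit) mem_Collect_eq)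
qed

theorem proposition1p5:
  fixes w :: "int ^ 'd \<Rightarrow> int ^ 'd \<Rightarrow> real"
  assumes w_sym: "\<And>x y. w x y = w y x"
    and w_pos: "\<And>x y. adj x y \<Longrightarrow> w x y > 0"
    and w_zero: "\<And>x y. \<not> adj x y \<Longrightarrow> w x y = 0"
    and mu_bounds: "0 < mu_min w" "mu_min w \<le> mu_max w" "mu_max w < \<infinity>"
    and w_inf: "0 < (INF (x, y)\<in>{(x, y). adj x y}. ereal (w x y))"
  shows "\<exists>u :: nat \<Rightarrow> int ^ 'd \<Rightarrow> real.
    (\<forall>n\<ge>1. u n \<in> ell2 w \<and> ell2_norm w (u n) = 1 \<and>
       (\<lambda>(x, y). u n x * u n y * W_kernel w x y) summable_on UNIV) \<and>
    filterlim (\<lambda>n. \<Sum>\<^sub>\<infinity>(x, y). u n x * u n y * W_kernel w x y) at_top sequentially"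
proof -
  obtain c where c: "0 < c" "ereal c < (INF (x, y)\<in>{(x, y). adj x y}. ereal (w x y))"
    using ereal_dense2[OF w_inf] by (auto simp: zero_ereal_def)
  have w_ge: "c \<le> w x y" if "adj x y" for x y
    using less_INF_D[OF c(2), of "(x, y)"] that by simp
  obtain M where M: "mu_max w < ereal M"
    using ereal_dense2[OF mu_bounds(3)] by auto
  have measure_le: "vertex_measure w x \<le> M" for x
    using SUP_lessD[OF M[unfolded mu_max_def], of x] by simp
  interpret lattice_weights w c M
    by unfold_locales (fact w_sym w_zero c(1) w_ge measure_le)+
  define B where "B n = (cube 0 (int n) :: (int ^ 'd) set)" for n
  (* Neighbours of points of I n stay inside B n, so B n - I n is the inner boundary. *)
  define I where "I n = (cube 1 (int n - 1) :: (int ^ 'd) set)" for n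
  define m where "m n = (\<Sum>x\<in>B n. \<mu> x)" for n
  define u where "u n x = indicator (B n) x / sqrt (m n)" for n x
  have B: "finite (B n)" "card (B n) = n ^ CARD('d)" for n
    using cube_card[of 0 "int n"] by (auto simp: B_def)
  have I: "finite (I n)" "card (I n) = (n - 2) ^ CARD('d)" for n
    using cube_card[of 1 "int n - 1"] by (auto simp: I_def nat_diff_distrib')
  have I_B: "I n \<subseteq> B n" for n by (auto simp: I_def B_def cube_def) (smt (verit))+
  have adj_I: "y \<in> B n" if "x \<in> I n" "adj x y" for x y n
    using adj_cube[of x 1 "int n - 1" y] that by (simp add: I_def B_def)
  have m_ge: "c * n ^ CARD('d) \<le> m n" for n
    using sum_mono[of "B n" "\<lambda>_. c" \<mu>] measure_ge by (simp add: m_def B mult.commute)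
  have m_pos: "0 < m n" if "1 \<le> n" for n
    using m_ge[of n] that c_pos by (smt (verit) mult_pos_pos of_nat_0_less_iff zero_less_power less_le_trans zero_less_one)
  have boundary: "(\<Sum>x\<in>B n - I n. \<mu> x) \<le> M * (real n ^ CARD('d) - real (n - 2) ^ CARD('d))" for n
  proof -
    have "(\<Sum>x\<in>B n - I n. \<mu> x) \<le> (\<Sum>x\<in>B n - I n. M)" by (intro sum_mono measure_le)
    also have "\<dots> = M * real (card (B n - I n))" by simp
    also have "real (card (B n - I n)) = real n ^ CARD('d) - real (n - 2) ^ CARD('d)"
      using card_mono[OF B(1) I_B, of n] by (simp add: card_Diff_subset I I_B B of_nat_diff)
    finally show ?thesis .
  qed
  have u_ell2: "u n \<in> ell2 w" "ell2_norm w (u n) = 1" if "1 \<le> n" for n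
  proof -
    have "(\<lambda>x. \<bar>u n x\<bar>\<^sup>2 * \<mu> x) summable_on B n" using B by (intro summable_on_finite)
    then show "u n \<in> ell2 w" unfolding ell2_def mem_Collect_eq
      by (rule summable_on_cong_neutral[THEN iffD1, rotated -1]) (auto simp: u_def)
    have "(\<Sum>\<^sub>\<infinity>x. \<bar>u n x\<bar>\<^sup>2 * \<mu> x) = T (\<lambda>x. \<bar>u n x\<bar>\<^sup>2)" by (simp add: total_def)
    also have "\<dots> = (\<Sum>x\<in>B n. \<bar>u n x\<bar>\<^sup>2 * \<mu> x)" by (rule total_eq_sum[OF B(1)]) (simp add: u_def)
    also have "\<dots> = (\<Sum>x\<in>B n. \<mu> x / m n)"
    proof (rule sum.cong[OF refl])
      fix x assume "x \<in> B n"
      then have "\<bar>u n x\<bar>\<^sup>2 = 1 / m n"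
        using m_pos[OF that] unfolding power2_abs by (simp add: u_def power_divide)
      then show "\<bar>u n x\<bar>\<^sup>2 * \<mu> x = \<mu> x / m n" by simp
    qed
    also have "\<dots> = (\<Sum>x\<in>B n. \<mu> x) / m n" by (rule sum_divide_distrib[symmetric])
    also have "\<dots> = 1" using m_pos[OF that] by (simp add: m_def)
    finally show "ell2_norm w (u n) = 1" by (simp add: ell2_norm_def)
  qed
  let ?f = "\<lambda>n (x, y). u n x * u n y * W_kernel w x y"
  have f_zero: "?f n p = 0" if "p \<notin> B n \<times> B n" for n p
    using that by (auto simp: u_def indicator_def split: prod.splits)
  have f_summable: "?f n summable_on UNIV" for n
  proof -
    have "?f n summable_on (B n \<times> B n)" using B by (intro summable_on_finite) auto
    then show ?thesis
      by (rule summable_on_cong_neutral[THEN iffD1, rotated -1]) (use f_zero in auto)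
  qed
  have f_sum: "infsum (?f n) UNIV = (\<Sum>x\<in>B n. \<Sum>y\<in>B n. W_kernel w x y) / m n" if "1 \<le> n" for n
  proof -
    have "infsum (?f n) UNIV = infsum (?f n) (B n \<times> B n)"
      by (rule infsum_cong_neutral) (use f_zero in auto)
    also have "\<dots> = (\<Sum>x\<in>B n. \<Sum>y\<in>B n. u n x * u n y * W_kernel w x y)"
      using B by (simp add: sum.cartesian_product)
    also have "\<dots> = (\<Sum>x\<in>B n. \<Sum>y\<in>B n. W_kernel w x y / m n)"
      using m_pos[OF that] by (intro sum.cong refl) (simp add: u_def)
    finally show ?thesis by (simp add: sum_divide_distrib)
  qed
  have lim: "(\<lambda>n. M * (1 - ((real n - 2) / real n) ^ CARD('d))) \<longlonglongrightarrow> 0"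
  proof -
    have "(\<lambda>n. M * (1 - (1 - 2 * (1 / real n)) ^ CARD('d))) \<longlonglongrightarrow> M * (1 - (1 - 2 * 0) ^ CARD('d))"
      by (intro tendsto_intros lim_1_over_n)
    then have "(\<lambda>n. M * (1 - (1 - 2 * (1 / real n)) ^ CARD('d))) \<longlonglongrightarrow> 0" by simp
    then show ?thesis
      by (rule Lim_transform_eventually)
        (rule eventually_mono[OF eventually_gt_at_top[of 0]], simp add: diff_divide_distrib)
  qed
  have "filterlim (\<lambda>n. infsum (?f n) UNIV) at_top sequentially"
    unfolding filterlim_at_top_ge[where c = 0]
  proof (intro allI impI)
    fix Z :: real assume "0 \<le> Z"
    (* The form will be at least ln R / 2. *)
    define R where "R = exp (2 * Z)"
    have R: "1 \<le> R" using \<open>0 \<le> Z\<close> by (simp add: R_def)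
    have "(\<lambda>n. R * (M * (1 - ((real n - 2) / real n) ^ CARD('d)))) \<longlonglongrightarrow> R * 0"
      by (intro tendsto_mult_left lim)
    then have "\<forall>\<^sub>F n in sequentially. R * (M * (1 - ((real n - 2) / real n) ^ CARD('d))) < c / 2"
      using c_pos by (intro order_tendstoD) auto
    then show "\<forall>\<^sub>F n in sequentially. Z \<le> infsum (?f n) UNIV"
      using eventually_ge_at_top[of 2]
    proof eventually_elim
      case (elim n)
      have n: "1 \<le> n" "0 < real n ^ CARD('d)" using elim(2) by auto
      have scaled: "real (n - 2) ^ CARD('d) = ((real n - 2) / real n) ^ CARD('d) * real n ^ CARD('d)"
        using elim(2) by (simp add: power_divide of_nat_diff)
      have "R * (\<Sum>x\<in>B n - I n. \<mu> x) \<le> R * (M * (real n ^ CARD('d) - real (n - 2) ^ CARD('d)))"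
        using R by (intro mult_left_mono boundary) auto
      also have "\<dots> = R * (M * (1 - ((real n - 2) / real n) ^ CARD('d))) * n ^ CARD('d)"
        using scaled by (simp add: left_diff_distrib)
      also have "\<dots> \<le> c / 2 * n ^ CARD('d)"
        using elim(1) n by (intro mult_right_mono) auto
      also have "\<dots> \<le> m n / 2" using m_ge[of n] by simp
      finally have "m n / 2 * ln R \<le> (\<Sum>x\<in>B n. \<Sum>y\<in>B n. W_kernel w x y)"
        unfolding m_def by (intro sum_W_kernel_ge[OF B(1) adj_I R])
      then show ?case
        unfolding f_sum[OF n(1)] using m_pos[OF n(1)] by (simp add: R_def field_simps)
    qed
  qed
  then show ?thesis using u_ell2 f_summable by (intro exI[of _ u]) auto
qed

end
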